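(* Let $x,y\in\mathbb{R}$ with $1\le x<y$. If $\xi(x)=\xi(y)$, then there exists at least one prime in the interval $(x,y]$.
   Context: For an integer $n\ge 1$ put $\iota(n)=(-1)^{\pi(n)}$, where $\pi(n)$ is the number of primes $\le n$. For real $x\ge 1$ put $\xi(x)=\sum_{n\le x}\iota(n)$, the sum running over integers $1\le n\le x$.
   Formalization: The formal statement adds the hypothesis that the floor of x is less than the floor of y, i.e. (x,y] contains an integer; without it the claim fails, e.g. x = 1, y = 3/2 gives ξ(x) = ξ(y) = 1 but (1, 3/2] contains no prime. *)

theory Defs
  imports Complex_Main "HOL-Computational_Algebra.Primes"
begin

definition prime_pi :: "nat \<Rightarrow> nat" where
  "prime_pi n = card {p :: nat. prime p \<and> p \<le> n}"

definition iota :: "nat \<Rightarrow> int" where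
  "iota n = (- 1) ^ prime_pi n"

text \<open>As a function of a real variable, \<open>xi\<close> is a step function: it is constant between
  consecutive integers. Hence \<open>xi x = xi y\<close> holds trivially when the interval from \<open>x\<close>
  (exclusive) to \<open>y\<close> (inclusive) contains no integer, i.e. when \<open>\<lfloor>x\<rfloor> = \<lfloor>y\<rfloor>\<close>.\<close>

definition xi :: "real \<Rightarrow> int" where
  "xi x = (\<Sum>n \<in> {n :: nat. 1 \<le> n \<and> real n \<le> x}. iota n)"

end

theory Submission
  imports Defs
begin

text \<open>The sign \<open>iota\<close> flips only at primes. If (x, y] contains no prime, all
  integers in it carry one common sign (\<open>iota_const_no_prime\<close>), so by
  \<open>xi_diff\<close> the difference \<open>xi y - xi x\<close> is plus or minus their number.
  Equality of the two values then leaves no integer in (x, y], whereas the floor hypothesis supplies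
  one.\<close>

lemma finite_nat_le_real: "finite {n :: nat. P n \<and> real n \<le> x}"
  by (rule finite_subset[of _ "{..nat \<lfloor>x\<rfloor>}"]) (use le_nat_floor in auto)

lemma xi_diff:
  assumes "1 \<le> x" and "x \<le> y"
  shows "xi y - xi x = (\<Sum>n \<in> {n :: nat. x < real n \<and> real n \<le> y}. iota n)"
proof -
  have "{n :: nat. 1 \<le> n \<and> real n \<le> y} =
      {n. 1 \<le> n \<and> real n \<le> x} \<union> {n. x < real n \<and> real n \<le> y}"
    using assms by auto
  moreover have "{n :: nat. 1 \<le> n \<and> real n \<le> x} \<inter> {n. x < real n \<and> real n \<le> y} = {}"
    by auto
  ultimately show ?thesis
    unfolding xi_def by (simp add: sum.union_disjoint finite_nat_le_real)
qed

text \<open>A prime up to \<open>n\<close> is at most \<open>y\<close>, hence already at most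
  \<open>x\<close>. The exponent is thus the prime count at the real point \<open>x\<close>, free of
  \<open>n\<close>, which lets the sum over (x, y] collapse.\<close>

lemma iota_const_no_prime:
  assumes "\<nexists>p :: nat. prime p \<and> real p \<in> {x<..y}" and "x < real n" and "real n \<le> y"
  shows "iota n = (- 1) ^ card {p :: nat. prime p \<and> real p \<le> x}"
proof -
  have "p \<le> n \<longleftrightarrow> real p \<le> x" if "prime p" for p :: nat
  proof
    assume "p \<le> n"
    then have "real p \<le> y"
      using assms(3) by linarith
    then show "real p \<le> x"
      using assms(1) that by (meson greaterThanAtMost_iff not_le)
  next
    assume "real p \<le> x"
    then show "p \<le> n"
      using assms(2) by linarith
  qed
  then have "{p. prime p \<and> p \<le> n} = {p :: nat. prime p \<and> real p \<le> x}"
    by blast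
  then show ?thesis
    by (simp add: iota_def prime_pi_def)
qed

theorem theorem1p1:
  fixes x y :: real
  assumes "1 \<le> x" and "x < y"
    and "\<lfloor>x\<rfloor> < \<lfloor>y\<rfloor>"
    and "xi x = xi y"
  shows "\<exists>p :: nat. prime p \<and> real p \<in> {x<..y}"
proof (rule ccontr)
  assume no_prime: "\<not> ?thesis"
  define A where "A = {n :: nat. x < real n \<and> real n \<le> y}"
  have "0 = (\<Sum>n \<in> A. iota n)"
    using xi_diff[of x y] assms by (simp add: A_def)
  also have "\<dots> = (\<Sum>n \<in> A. (- 1) ^ card {p :: nat. prime p \<and> real p \<le> x})"
    by (rule sum.cong) (auto simp: A_def intro: iota_const_no_prime[OF no_prime])
  \<comment> \<open>The sum is \<open>card A\<close> times a power of -1, which is nonzero.\<close>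
  finally have "card A = 0"
    by simp
  \<comment> \<open>Since \<open>card\<close> is also 0 on infinite sets, emptiness of
    \<open>A\<close> requires finiteness.\<close>
  moreover have "finite A"
    unfolding A_def by (rule finite_nat_le_real)
  \<comment> \<open>As floors are integers, x < \<lfloor>x\<rfloor> + 1 \<le> \<lfloor>y\<rfloor>
    \<le> y.\<close>
  moreover have "nat \<lfloor>y\<rfloor> \<in> A"
    using assms by (simp add: A_def) linarith
  ultimately show False
    by auto
qed

end
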